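(* Let $t\in\mathbb{Z}_{\geq 0}$ and consider two-pile Nim with a one-time pass, where the pass is not allowed when both piles have at most $t$ stones. The following are equivalent: (1) for every position $\{x,y,p\}$ of this game, $\{x,y,p\}$ is a $\mathcal{P}$-position if and only if $x\oplus y\oplus p=0$; (2) $t$ is odd.
   Context: $\oplus$ denotes nim-sum (bitwise XOR of nonnegative integers). Game: there are two piles of stones, with $x$ and $y$ stones ($x,y\in\mathbb{Z}_{\geq 0}$). Two players alternate turns; on a turn a player removes any positive number of stones from one pile, or uses the pass move if it is available. The pass may be used at most once in the whole game: once it has been used by either player it is no longer available. The pass is not allowed when $x\leq t$ and $y\leq t$. The player who removes the last stone(s) wins. Positions: a position is an ordered triple $\{x,y,p\}$ with $p\in\{0,1\}$, where $p=1$ means the pass is still available and $p=0$ means it is not. Since the pass cannot be used when $x\leq t$ and $y\leq t$, in that case $p=0$; i.e. positions satisfy $p\leq F(x,y)$, where $F(x,y)=0$ if $x\leq t$ and $y\leq t$, and $F(x,y)=1$ otherwise. The moves from $\{x,y,p\}$ are: to $\{u,y,\min(p,F(u,y))\}$ for $0\leq u<x$; to $\{x,v,\min(p,F(x,v))\}$ for $0\leq v<y$; and, if $p=1$, to $\{x,y,0\}$ (the pass). A $\mathcal{P}$-position is a position from which the previous player (the player who just moved) wins with correct play; a player unable to move loses. *)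

theory Defs
  imports Main
begin

unbundle bit_operations_syntax

text \<open>A triple \<open>(x, y, p)\<close>: the two pile sizes, and \<open>p = 1\<close> iff the pass is still available.\<close>

type_synonym pos = "nat \<times> nat \<times> nat"

definition pass_cap :: "nat \<Rightarrow> nat \<Rightarrow> nat \<Rightarrow> nat" where
  "pass_cap t x y = (if x \<le> t \<and> y \<le> t then 0 else 1)"

text \<open>The bound also forces \<open>p \<in> {0, 1}\<close>.\<close>

definition positions :: "nat \<Rightarrow> pos set" where
  "positions t = {(x, y, p). p \<le> pass_cap t x y}"

inductive move :: "nat \<Rightarrow> pos \<Rightarrow> pos \<Rightarrow> bool" for t :: nat where
  first_pile:  "u < x \<Longrightarrow> move t (x, y, p) (u, y, min p (pass_cap t u y))"
| second_pile: "v < y \<Longrightarrow> move t (x, y, p) (x, v, min p (pass_cap t x v))"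
| pass:        "move t (x, y, 1) (x, y, 0)"

lemma move_positions:
  assumes "move t a b" and "a \<in> positions t"
  shows "b \<in> positions t"
  using assms by (cases rule: move.cases) (auto simp: positions_def)

text \<open>
  The player about to move, respectively the player who has just moved, can force a win.
  A player unable to move loses: a position without moves satisfies \<open>P_position\<close>, vacuously
  by its introduction rule. Being least fixed points, both predicates require the win to be
  reached after finitely many moves.
\<close>

inductive N_position :: "nat \<Rightarrow> pos \<Rightarrow> bool" and P_position :: "nat \<Rightarrow> pos \<Rightarrow> bool"
  for t :: nat where
  N_intro: "move t a b \<Longrightarrow> P_position t b \<Longrightarrow> N_position t a"
| P_intro: "(\<And>b. move t a b \<Longrightarrow> N_position t b) \<Longrightarrow> P_position t a"

end

(*
  With no pass left this is two-pile Nim, and with a pass left the claimed P-positions are the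
  pairs {2k, 2k + 1}. For odd t, such a pair not covered by the pass restriction lies
  entirely above t, so no move from it can lose the pass except the pass itself. For even t,
  the pair {t, t + 1} can be moved to the P-position {t, t}, since doing so loses the pass.
*)
theory Submission
  imports Defs
begin

lemma xor_eq_0_iff_nat: "x XOR y = 0 \<longleftrightarrow> x = y" for x y :: nat
  by (metis xor.assoc xor.right_neutral xor.left_neutral xor_self_eq)

lemma N_position_iff: "N_position t a \<longleftrightarrow> (\<exists>b. move t a b \<and> P_position t b)"
  by (subst N_position.simps) blast

lemma P_position_iff: "P_position t a \<longleftrightarrow> (\<forall>b. move t a b \<longrightarrow> N_position t b)"
  by (subst P_position.simps) blast

text \<open>Mutual induction suffices: a winning move leads to a P-position, and the induction
  hypothesis denies that it is also an N-position.\<close>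

lemma not_N_and_P:
  shows "N_position t a \<Longrightarrow> \<not> P_position t a"
    and "P_position t a \<Longrightarrow> \<not> N_position t a"
proof (induction rule: N_position_P_position.inducts)
  case (N_intro a b)
  then show ?case using P_position_iff by blast
next
  case (P_intro a)
  then show ?case using N_position_iff by blast
qed

text \<open>Counting \<open>p\<close> along with the stones makes the pass strictly decreasing too;
  pile moves never raise \<open>p\<close>.\<close>

lemma move_decreases: "move t (x, y, p) (u, v, q) \<Longrightarrow> u + v + q < x + y + p"
  by (erule move.cases) auto

text \<open>\<open>K\<close> acts as a kernel of the game graph on the legal positions
  \<open>S\<close>. Induction on the decreasing measure puts \<open>K\<close> among the P-positions
  and the rest of \<open>S\<close> among the N-positions; exclusiveness gives the converse.\<close>

lemma P_position_iff_kernel: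
  assumes closed: "\<And>a b. a \<in> S \<Longrightarrow> move t a b \<Longrightarrow> b \<in> S"
    and stable: "\<And>a b. a \<in> S \<Longrightarrow> a \<in> K \<Longrightarrow> move t a b \<Longrightarrow> b \<notin> K"
    and absorbing: "\<And>a. a \<in> S \<Longrightarrow> a \<notin> K \<Longrightarrow> \<exists>b. move t a b \<and> b \<in> K"
    and "a \<in> S"
  shows "P_position t a \<longleftrightarrow> a \<in> K"
proof -
  have "(a \<in> K \<longrightarrow> P_position t a) \<and> (a \<notin> K \<longrightarrow> N_position t a)"
    using \<open>a \<in> S\<close>
  proof (induction a rule: measure_induct_rule[where f = "\<lambda>(x, y, p). x + y + p"])
    case (less a)
    have IH: "(b \<in> K \<longrightarrow> P_position t b) \<and> (b \<notin> K \<longrightarrow> N_position t b)" if "move t a b" for b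
      using less.IH[of b] closed[OF less.prems that] that
      by (cases a; cases b) (auto dest: move_decreases)
    show ?case
      using IH stable[OF less.prems] absorbing[OF less.prems]
        N_position_iff[of t a] P_position_iff[of t a] by blast
  qed
  then show ?thesis using not_N_and_P by blast
qed

lemma move_swap:
  assumes "move t (x, y, p) (u, v, q)"
  shows "move t (y, x, p) (v, u, q)"
  using assms
proof (cases rule: move.cases)
  case first_pile
  then show ?thesis
    using move.second_pile[of u x t y p] by (auto simp: pass_cap_def conj_commute)
next
  case second_pile
  then show ?thesis
    using move.first_pile[of v y t x p] by (auto simp: pass_cap_def conj_commute)
next
  case pass
  then show ?thesis using move.pass by simp
qed

definition nim_zero :: "pos set" where
  "nim_zero = {(x, y, p). x XOR y XOR p = 0}"

lemma nim_zero_iff: "(x, y, p) \<in> nim_zero \<longleftrightarrow> x = y XOR p"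
  by (simp add: nim_zero_def xor_eq_0_iff_nat)

lemma nim_zero_swap: "(x, y, p) \<in> nim_zero \<longleftrightarrow> (y, x, p) \<in> nim_zero"
  by (simp add: nim_zero_def xor.left_commute)

text \<open>The larger pile is reduced to \<open>y XOR q\<close>, where \<open>q\<close> is the pass
  status after the move; the case split finds a consistent \<open>q\<close>.\<close>

lemma winning_move_less:
  assumes "y < x" and "p \<le> 1" and "(x, y, p) \<notin> nim_zero"
  shows "\<exists>b. move t (x, y, p) b \<and> b \<in> nim_zero"
proof (cases "p = 1 \<and> pass_cap t (y XOR 1) y = 1")
  case True
  \<comment> \<open>\<open>y XOR 1\<close> is at most \<open>y + 1\<close>, hence at most
    \<open>x\<close>; equality would put the position in \<open>nim_zero\<close>.\<close>
  have "y XOR 1 < x"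
    using assms True by (auto simp: nim_zero_iff xor_Suc_0_eq of_bool_def split: if_splits)
  from move.first_pile[OF this, of t y 1] show ?thesis
    using True by (auto simp: nim_zero_iff)
next
  case False
  \<comment> \<open>Either there is no pass left, or equalizing the piles at \<open>y \<le> t\<close> destroys it.\<close>
  then have "min p (pass_cap t y y) = 0"
    using \<open>p \<le> 1\<close> by (auto simp: pass_cap_def split: if_splits)
  then have "move t (x, y, p) (y, y, 0)"
    using move.first_pile[OF \<open>y < x\<close>, of t y p] by simp
  then show ?thesis
    by (intro exI[of _ "(y, y, 0)"]) (simp add: nim_zero_iff)
qed

lemma winning_move:
  assumes "p \<le> 1" and "(x, y, p) \<notin> nim_zero"
  shows "\<exists>b. move t (x, y, p) b \<and> b \<in> nim_zero"
proof (cases x y rule: linorder_cases)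
  case less
  then obtain u v q where "move t (y, x, p) (u, v, q)" "(u, v, q) \<in> nim_zero"
    using winning_move_less[of x y p t] assms nim_zero_swap by (metis prod_cases3)
  then show ?thesis using move_swap nim_zero_swap by blast
next
  case equal
  \<comment> \<open>Equal piles without a pass lie in \<open>nim_zero\<close>, so here the pass is
    available and wins.\<close>
  then have "p = 1"
    using assms by (cases "p = 0") (auto simp: nim_zero_iff)
  then show ?thesis
    using equal move.pass[of t x y] by (intro exI[of _ "(x, y, 0)"]) (simp add: nim_zero_iff)
next
  case greater
  then show ?thesis using winning_move_less assms by blast
qed

text \<open>A pile move that leaves \<open>p\<close> unchanged breaks \<open>x = y XOR p\<close>.
  Oddness of \<open>t\<close> ensures that pile moves from here do leave it unchanged.\<close>

lemma nim_zero_stable: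
  assumes "odd t" and pos: "(x, y, p) \<in> positions t" and zero: "(x, y, p) \<in> nim_zero"
    and "move t (x, y, p) b"
  shows "b \<notin> nim_zero"
proof -
  \<comment> \<open>The piles are \<open>2k\<close> and \<open>2k + 1\<close>, and legality puts the
    larger above \<open>t\<close>. So \<open>2k\<close> is at least \<open>t\<close>, and differs
    from it because \<open>t\<close> is odd.\<close>
  have above: "t < x \<and> t < y" if "p = 1"
    using assms that
    by (auto simp: positions_def pass_cap_def nim_zero_iff xor_Suc_0_eq of_bool_def split: if_splits elim!: oddE evenE)
  have p: "p = 0 \<or> p = 1"
    using pos by (auto simp: positions_def pass_cap_def split: if_splits)
  from \<open>move t (x, y, p) b\<close> show ?thesis
  proof (cases rule: move.cases)
    case (first_pile u)
    \<comment> \<open>If \<open>p = 1\<close>, the untouched pile still exceeds \<open>t\<close>, so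
      the pass survives.\<close>
    then have "min p (pass_cap t u y) = p"
      using p above by (auto simp: pass_cap_def)
    then show ?thesis using first_pile zero by (simp add: nim_zero_iff)
  next
    case (second_pile v)
    then have "min p (pass_cap t x v) = p"
      using p above by (auto simp: pass_cap_def)
    then show ?thesis
      using second_pile zero nim_zero_swap[of x] nim_zero_iff[of _ x p] by auto
  next
    case pass
    \<comment> \<open>Membership after the pass would need \<open>x = y\<close>, but before it
      \<open>x = y XOR 1\<close>.\<close>
    then show ?thesis
      using zero by (auto simp: nim_zero_iff xor_Suc_0_eq of_bool_def split: if_splits elim!: oddE)
  qed
qed

theorem theorem7:
  fixes t :: nat
  shows "(\<forall>x y p. (x, y, p) \<in> positions t \<longrightarrow>
            (P_position t (x, y, p) \<longleftrightarrow> x XOR y XOR p = 0))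
         \<longleftrightarrow> odd t"
proof
  assume *: "\<forall>x y p. (x, y, p) \<in> positions t \<longrightarrow>
            (P_position t (x, y, p) \<longleftrightarrow> x XOR y XOR p = 0)"
  show "odd t"
  proof
    assume "even t"
    \<comment> \<open>For even \<open>t\<close>, \<open>t XOR 1 = Suc t\<close>; the pile
      \<open>Suc t\<close> exceeds \<open>t\<close>, so the pass may still be available.\<close>
    then have "(Suc t, t, 1) \<in> nim_zero"
      by (simp add: nim_zero_iff xor_Suc_0_eq)
    then have "P_position t (Suc t, t, 1)"
      using * by (simp add: positions_def pass_cap_def nim_zero_def)
    moreover have "P_position t (t, t, 0)"
      using * by (simp add: positions_def)
    moreover have "move t (Suc t, t, 1) (t, t, 0)"
      using move.first_pile[of t "Suc t" t t 1] by (simp add: pass_cap_def)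
    ultimately show False
      using N_intro not_N_and_P by blast
  qed
next
  assume "odd t"
  have "P_position t a \<longleftrightarrow> a \<in> nim_zero" if "a \<in> positions t" for a
  proof (rule P_position_iff_kernel[OF _ _ _ that])
    show "b \<in> positions t" if "a \<in> positions t" "move t a b" for a b
      using move_positions that by blast
    show "b \<notin> nim_zero" if "a \<in> positions t" "a \<in> nim_zero" "move t a b" for a b
      using nim_zero_stable[OF \<open>odd t\<close>] that by (metis prod_cases3)
    show "\<exists>b. move t a b \<and> b \<in> nim_zero" if "a \<in> positions t" "a \<notin> nim_zero" for a
      using that winning_move
      by (cases a) (auto simp: positions_def pass_cap_def split: if_splits)
  qed
  then show "\<forall>x y p. (x, y, p) \<in> positions t \<longrightarrow>
            (P_position t (x, y, p) \<longleftrightarrow> x XOR y XOR p = 0)"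
    by (simp add: nim_zero_def)
qed

end
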